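(* Let $\kappa$ be an infinite cardinal, let $X$ be a real Banach space that is $\mathrm{ASQ}_{<\kappa}$ and let $Y\subseteq X$ be a $\kappa$ almost isometric ideal in $X$. Then $Y$ is $\mathrm{ASQ}_{<\kappa}$.
   Context: For a normed space $Z$, $\operatorname{dens}(Z)$ is the least cardinality of a subset of $Z$ whose linear span is dense in $Z$ (so it equals $\dim Z$ if $Z$ is finite dimensional); $S_Z$ is its unit sphere. A subspace $Y$ of a Banach space $X$ is a $\kappa$ almost isometric ideal in $X$ if for every subspace $E\subseteq X$ with $\operatorname{dens}(E)<\kappa$ and every $\varepsilon>0$ there is a linear operator $T:E\to Y$ with $(1-\varepsilon)\|e\|\le\|T(e)\|\le(1+\varepsilon)\|e\|$ for all $e\in E$ and $T(e)=e$ for all $e\in E\cap Y$. A normed space $X$ is $<\kappa$-almost square ($\mathrm{ASQ}_{<\kappa}$) if for every subspace $Z\subseteq X$ with $\operatorname{dens}(Z)<\kappa$ and every $\varepsilon>0$ there is $x\in S_X$ such that $\|z+\lambda x\|\le(1+\varepsilon)\max\{\|z\|,|\lambda|\}$ for all $z\in Z$ and $\lambda\in\mathbb R$. *)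

theory Defs
  imports "HOL-Analysis.Analysis"
begin

unbundle cardinal_syntax

text \<open>
  Normed spaces are given as linear subspaces of an ambient real normed space, carrying the
  restricted norm; the ambient space itself is \<^term>\<open>UNIV\<close>. Subspaces are linear subspaces and
  are not assumed to be closed. Cardinals are cardinal orders, which may live on any type.
\<close>

definition densely_spans :: "'a::real_normed_vector set \<Rightarrow> 'a set \<Rightarrow> bool" where
  "densely_spans D Z \<longleftrightarrow> D \<subseteq> Z \<and> Z \<subseteq> closure (span D)"

definition dens :: "'a::real_normed_vector set \<Rightarrow> 'a rel" where
  "dens Z = |SOME D. densely_spans D Z \<and> (\<forall>D'. densely_spans D' Z \<longrightarrow> |D| \<le>o |D'| )|"

text \<open>The minimum in \<^const>\<open>dens\<close> is attained, so the choice above is never vacuous.\<close>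

lemma dens_attained:
  obtains D where "densely_spans D Z" "dens Z = |D|" "\<And>D'. densely_spans D' Z \<Longrightarrow> dens Z \<le>o |D'|"
proof -
  let ?P = "\<lambda>D. densely_spans D Z \<and> (\<forall>D'. densely_spans D' Z \<longrightarrow> |D| \<le>o |D'| )"
  let ?R = "card_of ` {D. densely_spans D Z}"
  have "densely_spans Z Z"
    unfolding densely_spans_def using closure_subset span_superset by blast
  then have "?R \<noteq> {}" by blast
  moreover have "\<forall>r\<in>?R. Card_order r" by (auto intro: card_of_Card_order)
  ultimately obtain r where "r \<in> ?R" "\<forall>r'\<in>?R. r \<le>o r'"
    using exists_minim_Card_order[of ?R] by blast
  then have "\<exists>D. ?P D" by blast
  then have "?P (SOME D. ?P D)" by (rule someI_ex)
  then show ?thesis using that[of "SOME D. ?P D"] unfolding dens_def by blast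
qed

definition ASQ :: "'k rel \<Rightarrow> 'a::real_normed_vector set \<Rightarrow> bool" where
  "ASQ \<kappa> X \<longleftrightarrow>
    (\<forall>Z. subspace Z \<and> Z \<subseteq> X \<and> dens Z <o \<kappa> \<longrightarrow>
      (\<forall>\<epsilon>>0. \<exists>x \<in> X \<inter> sphere 0 1. \<forall>z\<in>Z. \<forall>t::real.
        norm (z + t *\<^sub>R x) \<le> (1 + \<epsilon>) * max (norm z) \<bar>t\<bar>))"

text \<open>Only the values on \<open>E\<close> of an operator with domain \<open>E\<close> matter.\<close>

definition linear_operator :: "'a::real_vector set \<Rightarrow> 'b::real_vector set \<Rightarrow> ('a \<Rightarrow> 'b) \<Rightarrow> bool" where
  "linear_operator E Y T \<longleftrightarrow>
    T ` E \<subseteq> Y \<and>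
    (\<forall>u\<in>E. \<forall>v\<in>E. T (u + v) = T u + T v) \<and>
    (\<forall>c. \<forall>u\<in>E. T (c *\<^sub>R u) = c *\<^sub>R T u)"

definition almost_isometric_ideal ::
  "'k rel \<Rightarrow> 'a::real_normed_vector set \<Rightarrow> 'a set \<Rightarrow> bool" where
  "almost_isometric_ideal \<kappa> Y X \<longleftrightarrow>
    subspace Y \<and> Y \<subseteq> X \<and>
    (\<forall>E. subspace E \<and> E \<subseteq> X \<and> dens E <o \<kappa> \<longrightarrow>
      (\<forall>\<epsilon>>0. \<exists>T. linear_operator E Y T \<and>
        (\<forall>e\<in>E. (1 - \<epsilon>) * norm e \<le> norm (T e) \<and> norm (T e) \<le> (1 + \<epsilon>) * norm e) \<and>
        (\<forall>e \<in> E \<inter> Y. T e = e)))"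

end

theory Submission
  imports Defs
begin

text \<open>
  The almost square direction \<open>x\<close> that \<open>X\<close> offers for a small subspace \<open>Z\<close> of \<open>Y\<close> need not lie in
  \<open>Y\<close>, but it can be moved there: the subspace \<open>E\<close> spanned by \<open>Z\<close> and \<open>x\<close> is still small, so there
  is an almost isometry \<open>T : E \<rightarrow> Y\<close> that fixes \<open>Z\<close>. The normalisation of \<open>T x\<close> does for \<open>Z\<close> inside
  \<open>Y\<close> what \<open>x\<close> did inside \<open>X\<close>, because \<open>z + s T x = T (z + s x)\<close> for \<open>z \<in> Z\<close>. Running both
  hypotheses with \<open>\<delta>\<close> in place of \<open>\<epsilon>\<close>, one factor \<open>1 + \<delta>\<close> is lost to the choice of \<open>x\<close>, another to
  \<open>T\<close>, and a factor \<open>1 / (1 - \<delta>)\<close> to the normalisation; a small \<open>\<delta>\<close> makes the product at most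
  \<open>1 + \<epsilon>\<close>.

  That \<open>E\<close> is small is \<open>dens_span_insert_less\<close>, where the infinity of \<open>\<kappa>\<close> enters; the estimate is
  \<open>almost_square_direction_image\<close>.
\<close>

lemma subspace_closure:
  fixes S :: "'a::real_normed_vector set"
  assumes "subspace S"
  shows "subspace (closure S)"
proof (rule subspaceI)
  show "0 \<in> closure S"
    using subspace_0[OF assms] closure_subset by blast
next
  fix u v assume "u \<in> closure S" "v \<in> closure S"
  then obtain f g where "\<And>n. f n \<in> S" "f \<longlonglongrightarrow> u" "\<And>n. g n \<in> S" "g \<longlonglongrightarrow> v"
    unfolding closure_sequential by blast
  then have "(\<lambda>n. f n + g n) \<longlonglongrightarrow> u + v" "\<And>n. f n + g n \<in> S"
    using assms by (auto intro: tendsto_add subspace_add)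
  then show "u + v \<in> closure S"
    unfolding closure_sequential by (intro exI[of _ "\<lambda>n. f n + g n"]) auto
next
  fix c u assume "u \<in> closure S"
  then obtain f where "\<And>n. f n \<in> S" "f \<longlonglongrightarrow> u"
    unfolding closure_sequential by blast
  then have "(\<lambda>n. c *\<^sub>R f n) \<longlonglongrightarrow> c *\<^sub>R u" "\<And>n. c *\<^sub>R f n \<in> S"
    using assms by (auto intro: tendsto_scaleR subspace_scale)
  then show "c *\<^sub>R u \<in> closure S"
    unfolding closure_sequential by (intro exI[of _ "\<lambda>n. c *\<^sub>R f n"]) auto
qed

lemma densely_spans_span_insert:
  assumes "densely_spans D Z"
  shows "densely_spans (insert x D) (span (insert x Z))"
proof -
  let ?C = "closure (span (insert x D))"
  have D: "D \<subseteq> Z" "Z \<subseteq> closure (span D)"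
    using assms by (auto simp: densely_spans_def)
  have "closure (span D) \<subseteq> ?C"
    by (intro closure_mono span_mono) auto
  moreover have "x \<in> ?C"
    using closure_subset span_base[of x "insert x D"] by blast
  ultimately have "insert x Z \<subseteq> ?C"
    using D by blast
  then have "span (insert x Z) \<subseteq> ?C"
    by (intro span_minimal subspace_closure subspace_span)
  moreover have "insert x D \<subseteq> span (insert x Z)"
    using D span_superset[of "insert x Z"] by blast
  ultimately show ?thesis
    by (simp add: densely_spans_def)
qed

text \<open>
  A densely spanning set of size \<open>dens Z\<close> needs only one more point, and adding one point cannot lift
  a cardinal up to an infinite one.
\<close>

lemma dens_span_insert_less:
  assumes "Cinfinite \<kappa>" and "dens Z <o \<kappa>"
  shows "dens (span (insert x Z)) <o \<kappa>"
proof -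
  obtain D where D: "densely_spans D Z" "dens Z = |D|"
    by (rule dens_attained)
  have inf: "\<not> finite (Field \<kappa>)" "Card_order \<kappa>"
    using assms(1) by (auto simp: cinfinite_def)
  then have "|{x}| <o \<kappa>"
    using assms(1) by (intro Cfinite_ordLess_Cinfinite) (simp_all add: cfinite_def Field_card_of card_of_card_order_on)
  then have "|{x} \<union> D| <o \<kappa>"
    using inf D assms(2) by (intro card_of_Un_ordLess_infinite_Field) auto
  moreover have "dens (span (insert x Z)) \<le>o |insert x D|"
    using densely_spans_span_insert[OF D(1)] by (metis dens_attained)
  ultimately show ?thesis
    by (auto intro: ordLeq_ordLess_trans)
qed

text \<open>
  By linearity, \<open>T z + t y = T (z + s x)\<close> for the unit vector \<open>y\<close> in the direction of \<open>T x\<close> and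
  \<open>s = t / \<parallel>T x\<parallel>\<close>. Since \<open>\<parallel>T x\<parallel> \<ge> 1 - \<delta>\<close>, the maximum of \<open>\<parallel>z\<parallel>\<close> and \<open>\<bar>s\<bar>\<close> exceeds that of \<open>\<parallel>z\<parallel>\<close>
  and \<open>\<bar>t\<bar>\<close> by a factor of at most \<open>1 / (1 - \<delta>)\<close>.
\<close>

lemma almost_square_direction_image:
  fixes Z :: "'a::real_normed_vector set" and T :: "'a \<Rightarrow> 'b::real_normed_vector"
  assumes "0 \<le> \<delta>" and "\<delta> < 1" and "norm x = 1"
    and square: "\<And>z s. z \<in> Z \<Longrightarrow> norm (z + s *\<^sub>R x) \<le> (1 + \<delta>) * max (norm z) \<bar>s\<bar>"
    and T: "linear_operator (span (insert x Z)) Y T"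
    and lower: "\<And>e. e \<in> span (insert x Z) \<Longrightarrow> (1 - \<delta>) * norm e \<le> norm (T e)"
    and upper: "\<And>e. e \<in> span (insert x Z) \<Longrightarrow> norm (T e) \<le> (1 + \<delta>) * norm e"
    and "z \<in> Z"
  shows "norm (T z + t *\<^sub>R sgn (T x)) \<le> (1 + \<delta>)\<^sup>2 / (1 - \<delta>) * max (norm z) \<bar>t\<bar>"
proof -
  let ?E = "span (insert x Z)"
  have xE: "x \<in> ?E" and zE: "z \<in> ?E"
    using \<open>z \<in> Z\<close> by (auto intro: span_base)
  define s where "s = t / norm (T x)"
  have Tx: "1 - \<delta> \<le> norm (T x)"
    using lower[OF xE] \<open>norm x = 1\<close> by simp
  have "s *\<^sub>R x \<in> ?E"
    using xE by (rule span_scale)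
  then have "T z + t *\<^sub>R sgn (T x) = T (z + s *\<^sub>R x)"
    using T xE zE by (simp add: linear_operator_def s_def sgn_div_norm divide_inverse)
  also have "norm \<dots> \<le> (1 + \<delta>) * norm (z + s *\<^sub>R x)"
    using upper span_add[OF zE \<open>s *\<^sub>R x \<in> ?E\<close>] by blast
  also have "\<dots> \<le> (1 + \<delta>) * ((1 + \<delta>) * max (norm z) \<bar>s\<bar>)"
    using square[OF \<open>z \<in> Z\<close>] \<open>0 \<le> \<delta>\<close> by (intro mult_left_mono) auto
  also have "\<dots> \<le> (1 + \<delta>) * ((1 + \<delta>) * (max (norm z) \<bar>t\<bar> / (1 - \<delta>)))"
  proof -
    have "norm z * (1 - \<delta>) \<le> norm z"
      using \<open>0 \<le> \<delta>\<close> by (simp add: mult_left_le)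
    then have "norm z \<le> norm z / (1 - \<delta>)"
      using \<open>\<delta> < 1\<close> by (simp add: pos_le_divide_eq)
    also have "\<dots> \<le> max (norm z) \<bar>t\<bar> / (1 - \<delta>)"
      using \<open>\<delta> < 1\<close> by (intro divide_right_mono) auto
    finally have "norm z \<le> max (norm z) \<bar>t\<bar> / (1 - \<delta>)" .
    moreover have "\<bar>s\<bar> \<le> max (norm z) \<bar>t\<bar> / (1 - \<delta>)"
      unfolding s_def abs_divide abs_norm_cancel
      using Tx \<open>\<delta> < 1\<close> by (intro frac_le) auto
    ultimately show ?thesis
      using \<open>0 \<le> \<delta>\<close> by (intro mult_left_mono) auto
  qed
  finally show ?thesis
    by (simp add: power2_eq_square algebra_simps)
qed

theorem proposition4p12:
  fixes \<kappa> :: "'k rel" and Y :: "'a::banach set"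
  assumes "Cinfinite \<kappa>"
    and "ASQ \<kappa> (UNIV :: 'a set)"
    and "almost_isometric_ideal \<kappa> Y (UNIV :: 'a set)"
  shows "ASQ \<kappa> Y"
  unfolding ASQ_def
proof (intro allI impI, elim conjE)
  fix Z :: "'a set" and \<epsilon> :: real
  assume Z: "subspace Z" "Z \<subseteq> Y" "dens Z <o \<kappa>" and "\<epsilon> > 0"
  (* With \<delta> \<le> 1/2 the requirement (1 + \<delta>)^2 \<le> (1 + \<epsilon>) (1 - \<delta>) follows from 7 \<delta> \<le> \<epsilon>. *)
  define \<delta> where "\<delta> = min (1/2) (\<epsilon> / 7)"
  have \<delta>: "0 < \<delta>" "\<delta> \<le> 1/2" "7 * \<delta> \<le> \<epsilon>"
    using \<open>\<epsilon> > 0\<close> by (auto simp: \<delta>_def)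
  have "\<delta> * \<delta> \<le> 1/2 * \<delta>" "\<epsilon> * \<delta> \<le> \<epsilon> * (1/2)"
    using \<delta> \<open>\<epsilon> > 0\<close> by (intro mult_right_mono mult_left_mono; simp)+
  then have "(1 + \<delta>)\<^sup>2 \<le> (1 + \<epsilon>) * (1 - \<delta>)"
    unfolding power2_eq_square ring_distribs mult_1_left mult_1_right using \<delta>(3) by linarith
  then have \<delta>\<epsilon>: "(1 + \<delta>)\<^sup>2 / (1 - \<delta>) \<le> 1 + \<epsilon>"
    using \<delta> by (simp add: pos_divide_le_eq)
  obtain x where x: "norm x = 1"
    "\<And>z t. z \<in> Z \<Longrightarrow> norm (z + t *\<^sub>R x) \<le> (1 + \<delta>) * max (norm z) \<bar>t\<bar>"
    using assms(2) Z \<delta>(1) unfolding ASQ_def by fastforce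
  let ?E = "span (insert x Z)"
  have "subspace Y"
    using assms(3) by (simp add: almost_isometric_ideal_def)
  obtain T where T: "linear_operator ?E Y T"
    "\<And>e. e \<in> ?E \<Longrightarrow> (1 - \<delta>) * norm e \<le> norm (T e)"
    "\<And>e. e \<in> ?E \<Longrightarrow> norm (T e) \<le> (1 + \<delta>) * norm e"
    "\<And>e. e \<in> ?E \<Longrightarrow> e \<in> Y \<Longrightarrow> T e = e"
    using assms(3) dens_span_insert_less[OF assms(1) Z(3), of x] \<delta>(1)
    unfolding almost_isometric_ideal_def by (metis IntI subspace_span subset_UNIV)
  have xE: "x \<in> ?E"
    by (simp add: span_base)
  have "T x \<noteq> 0"
    using T(2)[OF xE] x(1) \<delta> by auto
  show "\<exists>y \<in> Y \<inter> sphere 0 1. \<forall>z\<in>Z. \<forall>t.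
      norm (z + t *\<^sub>R y) \<le> (1 + \<epsilon>) * max (norm z) \<bar>t\<bar>"
  proof (intro bexI ballI allI)
    have "T x \<in> Y"
      using T(1) xE by (auto simp: linear_operator_def)
    then show "sgn (T x) \<in> Y \<inter> sphere 0 1"
      using \<open>T x \<noteq> 0\<close> \<open>subspace Y\<close> by (simp add: sgn_div_norm subspace_scale)
  next
    fix z t assume "z \<in> Z"
    then have "T z = z"
      using T(4) Z(2) by (auto intro: span_base)
    then have "norm (z + t *\<^sub>R sgn (T x)) \<le> (1 + \<delta>)\<^sup>2 / (1 - \<delta>) * max (norm z) \<bar>t\<bar>"
      using almost_square_direction_image[of \<delta> x Z Y T z t] \<delta> x T \<open>z \<in> Z\<close> by auto
    also have "\<dots> \<le> (1 + \<epsilon>) * max (norm z) \<bar>t\<bar>"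
      using \<delta>\<epsilon> by (intro mult_right_mono) auto
    finally show "norm (z + t *\<^sub>R sgn (T x)) \<le> (1 + \<epsilon>) * max (norm z) \<bar>t\<bar>" .
  qed
qed

end
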